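(* $\Omega_T\subset\Omega$; that is, every Galois conjugate of $e^{h_{\mathrm{top}}(f)}$, for $f$ a post-critically finite unimodal map, is a Galois conjugate of some generalized Parry number.
   Context: A unimodal map is a continuous map $f:[0,1]\to[0,1]$ for which there is a point $c\in(0,1)$ (the critical, or turning, point) such that $f$ is strictly monotone on $[0,c]$ and on $[c,1]$, with opposite directions of monotonicity on the two intervals. It is post-critically finite (PCF) if the forward orbit $\{f^j(c): j\geq0\}$ is finite. The topological entropy of a piecewise monotonic interval map $f$ is $h_{\mathrm{top}}(f)=\lim_{n\to\infty}\frac1n\log\#\{\text{branches (maximal intervals) of monotonicity of } f^n\}$. $\Omega_T$ is the set of complex numbers that are Galois conjugates of $e^{h_{\mathrm{top}}(f)}$ for some PCF unimodal map $f$. Let $m\geq 1$ be an integer, $\beta\in(m,m+1]$ and $E=(E(0),\ldots,E(m))\in\{1,-1\}^{m+1}$. Partition $[0,1]$ into $I_0=[0,1/\beta]$, $I_k=(k/\beta,(k+1)/\beta]$ for $1\leq k\leq m-1$, and $I_m=(m/\beta,1]$. The generalized $\beta$-transformation $f_{\beta,E}:[0,1]\to[0,1]$ is given by $f_{\beta,E}(x)=\beta x-k$ if $x\in I_k$ and $E(k)=1$, and $f_{\beta,E}(x)=-\beta x+k+1$ if $x\in I_k$ and $E(k)=-1$. It is PCF if $\{f_{\beta,E}^j(1): j\geq 0\}$ is a finite set. A real number $\beta>1$ is a generalized Parry number if there is an $E\in\{1,-1\}^{m+1}$ (where $\beta\in(m,m+1]$) such that $f_{\beta,E}$ is PCF;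 such a $\beta$ is algebraic. $\Omega\subset\mathbb{C}$ is the set of all Galois conjugates of all generalized Parry numbers. The Galois conjugates of an algebraic number $\alpha$ are the complex roots, other than $\alpha$ itself, of the minimal polynomial of $\alpha$ over $\mathbb{Q}$. *)

theory Defs
  imports "HOL-Analysis.Analysis" "HOL-Computational_Algebra.Polynomial"
begin

section \<open>Galois conjugates\<close>

definition is_min_poly :: "complex \<Rightarrow> rat poly \<Rightarrow> bool" where
  "is_min_poly a p \<longleftrightarrow>
     lead_coeff p = 1 \<and> poly (map_poly of_rat p) a = 0 \<and>
     (\<forall>q. q \<noteq> 0 \<and> poly (map_poly of_rat q) a = 0 \<longrightarrow> degree p \<le> degree q)"

text \<open>The number itself is not one of its conjugates; the set is empty if \<open>a\<close> is transcendental.\<close>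

definition galois_conjugates :: "complex \<Rightarrow> complex set" where
  "galois_conjugates a =
     {z. z \<noteq> a \<and> (\<exists>p. is_min_poly a p \<and> poly (map_poly of_rat p) z = 0)}"

section \<open>Unimodal maps and topological entropy\<close>

text \<open>Self-maps of \<open>[0,1]\<close> are functions on all reals, of which only the values on
  \<open>{0..1}\<close> matter.\<close>

definition turning_point :: "(real \<Rightarrow> real) \<Rightarrow> real \<Rightarrow> bool" where
  "turning_point f c \<longleftrightarrow> 0 < c \<and> c < 1 \<and>
     (strict_mono_on {0..c} f \<and> strict_antimono_on {c..1} f \<or>
      strict_antimono_on {0..c} f \<and> strict_mono_on {c..1} f)"

definition unimodal :: "(real \<Rightarrow> real) \<Rightarrow> bool" where
  "unimodal f \<longleftrightarrow> continuous_on {0..1} f \<and> f ` {0..1} \<subseteq> {0..1} \<and> (\<exists>c. turning_point f c)"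

text \<open>The turning point of a unimodal map is unique.\<close>

definition pcf_unimodal :: "(real \<Rightarrow> real) \<Rightarrow> bool" where
  "pcf_unimodal f \<longleftrightarrow>
     unimodal f \<and> (\<exists>c. turning_point f c \<and> finite (range (\<lambda>j. (f ^^ j) c)))"

definition monotonicity_interval :: "(real \<Rightarrow> real) \<Rightarrow> real set \<Rightarrow> bool" where
  "monotonicity_interval g J \<longleftrightarrow>
     is_interval J \<and> J \<subseteq> {0..1} \<and> (mono_on J g \<or> antimono_on J g)"

definition branches :: "(real \<Rightarrow> real) \<Rightarrow> real set set" where
  "branches g =
     {J. monotonicity_interval g J \<and> (\<forall>K. monotonicity_interval g K \<and> J \<subseteq> K \<longrightarrow> K = J)}"

definition h_top :: "(real \<Rightarrow> real) \<Rightarrow> real" where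
  "h_top f = lim (\<lambda>n. 1 / real n * ln (real (card (branches (f ^^ n)))))"

definition Omega_T :: "complex set" where
  "Omega_T = (\<Union>f \<in> {f. pcf_unimodal f}. galois_conjugates (of_real (exp (h_top f))))"

section \<open>Generalized \<open>\<beta>\<close>-transformations\<close>

definition beta_interval :: "nat \<Rightarrow> real \<Rightarrow> nat \<Rightarrow> real set" where
  "beta_interval m \<beta> k =
     (if k = 0 then {0..1/\<beta>}
      else if k < m then {real k / \<beta> <.. (real k + 1) / \<beta>}
      else {real m / \<beta> <.. 1})"

text \<open>Only the values \<open>E 0, \<dots>, E m\<close> are used, and the map is only meaningful on \<open>{0..1}\<close>,
  where the intervals with index \<open>k \<le> m\<close> form a partition if \<open>m \<ge> 1\<close> and
  \<open>m < \<beta> \<le> m + 1\<close>.\<close>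

definition beta_map :: "nat \<Rightarrow> real \<Rightarrow> (nat \<Rightarrow> int) \<Rightarrow> real \<Rightarrow> real" where
  "beta_map m \<beta> E x =
     (let k = (THE k. k \<le> m \<and> x \<in> beta_interval m \<beta> k)
      in if E k = 1 then \<beta> * x - real k else - \<beta> * x + real k + 1)"

definition generalized_parry :: "real \<Rightarrow> bool" where
  "generalized_parry \<beta> \<longleftrightarrow>
     (\<exists>m::nat. 1 \<le> m \<and> real m < \<beta> \<and> \<beta> \<le> real m + 1 \<and>
       (\<exists>E. (\<forall>k\<le>m. E k \<in> {1, -1}) \<and> finite (range (\<lambda>j. (beta_map m \<beta> E ^^ j) 1))))"

definition Omega :: "complex set" where
  "Omega = (\<Union>\<beta> \<in> {\<beta>. generalized_parry \<beta>}. galois_conjugates (of_real \<beta>))"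

end

theory Submission
  imports Defs
begin

text \<open>Let \<open>s = exp (h_top f)\<close>. If \<open>s = 1\<close> there are no conjugates. Otherwise \<open>1 < s \<le> 2\<close> and
  \<open>s\<close> is itself a generalized Parry number: for \<open>m = 1\<close> and \<open>E = (1, -1)\<close> the map
  \<open>beta_map\<close> is the tent map of slope \<open>s\<close>, whose turning value is 1, so only the critical orbit
  of this tent map has to be finite. The number of points \<open>\<le> x\<close> that \<open>f\<close> sends to \<open>c\<close>
  in fewer than \<open>n\<close> steps, averaged over \<open>n\<close> with weights \<open>t ^ n\<close> for \<open>t\<close> increasing to
  \<open>1 / s\<close>, yields a monotone function \<open>H\<close> that turns \<open>f\<close> into a map of slope \<open>\<plusminus>s\<close> (the
  Milnor--Thurston semiconjugacy). It is needed only on finitely many points, where a convergent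
  subsequence exists, and it carries the finite critical orbit of \<open>f\<close> onto that of the tent map.\<close>

section \<open>Monotone functions and their branches\<close>

abbreviation monotonic_on :: "real set \<Rightarrow> (real \<Rightarrow> real) \<Rightarrow> bool" where
  "monotonic_on S g \<equiv> mono_on S g \<or> antimono_on S g"

abbreviation strictly_monotonic_on :: "real set \<Rightarrow> (real \<Rightarrow> real) \<Rightarrow> bool" where
  "strictly_monotonic_on S g \<equiv> strict_mono_on S g \<or> strict_antimono_on S g"

lemma strictly_monotonic_on_subset:
  "strictly_monotonic_on S g \<Longrightarrow> T \<subseteq> S \<Longrightarrow> strictly_monotonic_on T g"
  by (meson monotone_on_subset)

lemma monotonic_on_subset:
  "monotonic_on S g \<Longrightarrow> T \<subseteq> S \<Longrightarrow> monotonic_on T g"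
  by (meson monotone_on_subset)

lemma strictly_monotonic_imp_inj_on:
  assumes "strictly_monotonic_on S g" shows "inj_on g S"
  using assms
proof
  assume "strict_antimono_on S g"
  then show ?thesis
    by (intro linorder_inj_onI) (fastforce simp: monotone_on_def)+
qed (rule strict_mono_on_imp_inj_on)

lemma strictly_monotonic_imp_monotonic:
  assumes "strictly_monotonic_on S g" shows "monotonic_on S g"
  using assms
proof
  assume "strict_antimono_on S g"
  then have "antimono_on S g"
    unfolding monotone_on_def by (metis order_le_less order_refl)
  then show ?thesis ..
qed (auto intro: strict_mono_on_imp_mono_on)

lemma strictly_monotonic_on_comp:
  assumes "strictly_monotonic_on S g" "strictly_monotonic_on (g ` S) h"
  shows "strictly_monotonic_on S (h \<circ> g)"
  using assms unfolding monotone_on_def comp_def by (elim disjE) blast+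

text \<open>A strictly monotone \<open>g\<close> either preserves or reverses all comparisons
  exactly, so it can be cancelled. This peels one application of the map off an iterate.\<close>

lemma monotonic_on_comp_cancel:
  assumes g: "strictly_monotonic_on S g" and hg: "monotonic_on S (h \<circ> g)"
  shows "monotonic_on (g ` S) h"
proof -
  have *: "(strict_mono_on S g \<longrightarrow> (g x \<le> g y \<longleftrightarrow> x \<le> y)) \<and>
      (strict_antimono_on S g \<longrightarrow> (g x \<le> g y \<longleftrightarrow> y \<le> x))" if "x \<in> S" "y \<in> S" for x y
    using that unfolding monotone_on_def by (metis not_less order_le_less)
  show ?thesis
    using g hg * unfolding monotone_on_def[of _ "(\<le>)"] by auto
qed

section \<open>Images of closed intervals under strictly monotone maps\<close>

lemma image_Icc_strict_mono:
  fixes g :: "real \<Rightarrow> real"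
  assumes "continuous_on {a..b} g" "strict_mono_on {a..b} g" "a \<le> b"
  shows "g ` {a..b} = {g a..g b}"
proof
  show "g ` {a..b} \<subseteq> {g a..g b}"
    using strict_mono_on_imp_mono_on[OF assms(2)] \<open>a \<le> b\<close> by (auto simp: monotone_on_def)
  show "{g a..g b} \<subseteq> g ` {a..b}"
    using IVT'[of g a _ b] assms by force
qed

lemma image_Icc_strict_antimono:
  fixes g :: "real \<Rightarrow> real"
  assumes "continuous_on {a..b} g" "strict_antimono_on {a..b} g" "a \<le> b"
  shows "g ` {a..b} = {g b..g a}"
proof
  have "antimono_on {a..b} g"
    using assms(2) unfolding monotone_on_def by (metis order_le_less order_refl)
  then show "g ` {a..b} \<subseteq> {g b..g a}"
    using \<open>a \<le> b\<close> by (auto simp: monotone_on_def)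
  show "{g b..g a} \<subseteq> g ` {a..b}"
    using IVT2'[of g b _ a] assms by force
qed

lemma interior_image_strictly_monotonic:
  assumes "strictly_monotonic_on {a..b} g" "a < x" "x < b"
  shows "min (g a) (g b) < g x" "g x < max (g a) (g b)"
proof -
  have "a \<in> {a..b}" "x \<in> {a..b}" "b \<in> {a..b}"
    using assms by auto
  then have "g a < g x \<and> g x < g b \<or> g b < g x \<and> g x < g a"
    using assms unfolding monotone_on_def by blast
  then show "min (g a) (g b) < g x" "g x < max (g a) (g b)"
    by auto
qed

lemma image_Icc_strictly_monotonic:
  fixes g :: "real \<Rightarrow> real"
  assumes "continuous_on {a..b} g" "strictly_monotonic_on {a..b} g" "a \<le> b"
  shows "g ` {a..b} = {min (g a) (g b)..max (g a) (g b)}"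
  using assms(2)
proof
  assume m: "strict_mono_on {a..b} g"
  then have "g a \<le> g b"
    using \<open>a \<le> b\<close> strict_mono_on_imp_mono_on[OF m] by (auto simp: monotone_on_def)
  then show ?thesis
    using image_Icc_strict_mono[OF assms(1) m assms(3)] by simp
next
  assume m: "strict_antimono_on {a..b} g"
  then have "g b \<le> g a"
    using \<open>a \<le> b\<close> unfolding monotone_on_def
    by (metis atLeastAtMost_iff order_le_less order_refl)
  then show ?thesis
    using image_Icc_strict_antimono[OF assms(1) m assms(3)] by (simp add: min_def max_def)
qed

text \<open>\<open>C\<close> plays the role of the set of turning points of \<open>g\<close>. The
  branches are the closed intervals between consecutive points of \<open>C\<close> with 0 and 1
  added, and each is determined by its left end, which is 0 or lies in \<open>C\<close>.\<close>

lemma card_branches: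
  fixes g :: "real \<Rightarrow> real" and C :: "real set"
  assumes fin: "finite C" and C: "C \<subseteq> {0<..<1}"
    and mono: "\<And>a b. 0 \<le> a \<Longrightarrow> a \<le> b \<Longrightarrow> b \<le> 1 \<Longrightarrow> C \<inter> {a<..<b} = {} \<Longrightarrow> monotonic_on {a..b} g"
    and turn: "\<And>a b x. 0 \<le> a \<Longrightarrow> a < x \<Longrightarrow> x < b \<Longrightarrow> b \<le> 1 \<Longrightarrow> x \<in> C \<Longrightarrow> \<not> monotonic_on {a..b} g"
  shows "card (branches g) = card C + 1"
proof -
  \<comment> \<open>The next turning point to the right of \<open>p\<close>, or 1 if there is
    none.\<close>
  define nxt where "nxt p = Min (insert 1 {x \<in> C. p < x})" for p
  define lap where "lap p = {p..nxt p}" for p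
  have nxt_in: "nxt p = 1 \<or> (nxt p \<in> C \<and> p < nxt p)" for p
    using Min_in[of "insert 1 {x \<in> C. p < x}"] fin unfolding nxt_def by auto
  have nxt_le: "nxt p \<le> x" if "x \<in> C" "p < x" for x p
    unfolding nxt_def using that fin by (intro Min_le) auto
  have p01: "0 \<le> p" "p < 1" if "p \<in> insert 0 C" for p
    using that C by auto
  have nxt01: "p < nxt p" "nxt p \<le> 1" if "p \<in> insert 0 C" for p
    using nxt_in[of p] p01[OF that] C by auto
  have lap_mono: "monotonicity_interval g (lap p)" if p: "p \<in> insert 0 C" for p
  proof -
    have "C \<inter> {p<..<nxt p} = {}"
      using nxt_le by fastforce
    then have "monotonic_on {p..nxt p} g"
      using mono p01[OF p] nxt01[OF p] by auto
    then show ?thesis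
      using p01[OF p] nxt01[OF p] by (auto simp: lap_def monotonicity_interval_def)
  qed
  have no_turn: "x \<notin> C" if K: "monotonicity_interval g K" "y \<in> K" "z \<in> K" "y < x" "x < z" for K x y z
  proof
    assume "x \<in> C"
    have sub: "{y..z} \<subseteq> K"
      using K(1-3) mem_is_interval_1_I[of K y z] unfolding monotonicity_interval_def by auto
    have "monotonic_on {y..z} g"
      using K(1) monotonic_on_subset[OF _ sub, of g] unfolding monotonicity_interval_def by auto
    moreover have "0 \<le> y" "z \<le> 1"
      using K(1-3) by (auto simp: monotonicity_interval_def)
    ultimately show False
      using turn[of y x z] K(4,5) \<open>x \<in> C\<close> by blast
  qed
  have lap_max: "K = lap p" if p: "p \<in> insert 0 C" and K: "monotonicity_interval g K" "lap p \<subseteq> K" for p K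
  proof
    have pK: "p \<in> K" "nxt p \<in> K"
      using K nxt01[OF p] by (auto simp: lap_def)
    show "K \<subseteq> lap p"
    proof
      fix z assume z: "z \<in> K"
      then have z01: "0 \<le> z" "z \<le> 1"
        using K by (auto simp: monotonicity_interval_def)
      have "p \<le> z"
        using no_turn[OF K(1) z pK(2), of p] p nxt01[OF p] z01 by (cases "z < p") auto
      moreover have "z \<le> nxt p"
        using no_turn[OF K(1) pK(1) z, of "nxt p"] nxt_in[of p] nxt01[OF p] z01 by (cases "nxt p < z") auto
      ultimately show "z \<in> lap p"
        by (simp add: lap_def)
    qed
  qed (use K in simp)
  have "branches g = lap ` insert 0 C"
  proof
    show "lap ` insert 0 C \<subseteq> branches g"
      using lap_mono lap_max by (auto simp: branches_def)
    show "branches g \<subseteq> lap ` insert 0 C"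
    proof
      fix J assume J: "J \<in> branches g"
      \<comment> \<open>The left end of the lap containing \<open>J\<close> is the last candidate
        weakly to the left of all of \<open>J\<close>. If \<open>J\<close> reached beyond
        \<open>nxt p\<close>, that turning point would lie strictly between two points of
        \<open>J\<close>.\<close>
      define P where "P = {q \<in> insert 0 C. \<forall>z\<in>J. q \<le> z}"
      define p where "p = Max P"
      have "finite P" "0 \<in> P"
        using fin J by (auto simp: P_def branches_def monotonicity_interval_def)
      then have pP: "p \<in> P"
        unfolding p_def using Max_in[of P] by blast
      have p_ge: "q \<le> p" if "q \<in> P" for q
        using \<open>finite P\<close> that by (simp add: p_def)
      have Jm: "monotonicity_interval g J"
        using J by (simp add: branches_def)
      have pC: "p \<in> insert 0 C"
        using pP by (simp add: P_def)
      have "z \<le> nxt p" if z: "z \<in> J" for z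
      proof (rule ccontr)
        assume n: "\<not> z \<le> nxt p"
        have "z \<le> 1"
          using Jm z by (auto simp: monotonicity_interval_def)
        then have nC: "nxt p \<in> C" "p < nxt p"
          using n nxt_in[of p] by auto
        then have "nxt p \<notin> P"
          using p_ge by force
        then obtain y where "y \<in> J" "y < nxt p"
          using nC by (auto simp: P_def)
        then show False
          using no_turn[OF Jm _ z, of y "nxt p"] nC n by auto
      qed
      then have "J \<subseteq> lap p"
        using pP by (auto simp: lap_def P_def)
      then have "J = lap p"
        using J lap_mono[OF pC] by (auto simp: branches_def)
      then show "J \<in> lap ` insert 0 C"
        using pC by blast
    qed
  qed
  moreover have "inj_on lap (insert 0 C)"
    by (intro inj_onI) (metis Icc_eq_Icc lap_def less_imp_le nxt01(1))
  moreover have "0 \<notin> C"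
    using C by auto
  ultimately show ?thesis
    using fin by (simp add: card_image)
qed

section \<open>Sequences of exponential growth\<close>

text \<open>Division with remainder by a fixed \<open>m\<close> bounds \<open>u n\<close> by
  \<open>(n div m) * u m\<close> plus the value at the remainder, so the quotients converge to their
  infimum. That the limit is also a lower bound later yields the exponential lower bound on the
  growth.\<close>

lemma fekete:
  fixes u :: "nat \<Rightarrow> real"
  assumes sub: "\<And>m n. u (m + n) \<le> u m + u n" and nonneg: "\<And>n. 0 \<le> u n"
  obtains L where "(\<lambda>n. u n / real n) \<longlonglongrightarrow> L" "\<And>n. real n * L \<le> u n"
proof
  define L where "L = (INF n\<in>{1..}. u n / real n)"
  have bdd: "bdd_below ((\<lambda>n. u n / real n) ` {1..})"
    using nonneg by (intro bdd_belowI2[of _ 0]) auto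
  have L_le: "L \<le> u n / real n" if "n \<ge> 1" for n
    unfolding L_def using bdd that by (intro cINF_lower) auto
  show "real n * L \<le> u n" for n
    using L_le[of n] nonneg[of n] by (cases "n = 0") (auto simp: field_simps)
  have mult: "u (q * m + r) \<le> real q * u m + u r" for q m r
  proof (induction q)
    case (Suc q)
    have "u (Suc q * m + r) = u (m + (q * m + r))"
      by (simp add: algebra_simps)
    also have "\<dots> \<le> u m + u (q * m + r)"
      by (rule sub)
    finally show ?case
      using Suc by (simp add: algebra_simps)
  qed simp
  show "(\<lambda>n. u n / real n) \<longlonglongrightarrow> L"
  proof (rule order_tendstoI)
    fix l assume "l < L"
    show "\<forall>\<^sub>F n in sequentially. l < u n / real n"
      using eventually_ge_at_top[of 1] by eventually_elim (use L_le \<open>l < L\<close> in force)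
  next
    fix l assume "L < l"
    then obtain m where m: "m \<ge> 1" "u m / real m < l"
      unfolding L_def using cINF_less_iff[OF _ bdd] by auto
    \<comment> \<open>One bound for the values at all remainders \<open>n mod m\<close>; divided by
      \<open>n\<close> it vanishes.\<close>
    define M where "M = (\<Sum>r<m. u r)"
    have "(\<lambda>n. M / real n) \<longlonglongrightarrow> 0"
      by (rule lim_const_over_n)
    then have "\<forall>\<^sub>F n in sequentially. M / real n < l - u m / real m"
      using m by (intro order_tendstoD) auto
    then show "\<forall>\<^sub>F n in sequentially. u n / real n < l"
      using eventually_ge_at_top[of 1]
    proof eventually_elim
      case (elim n)
      have "u (n mod m) \<le> M"
        unfolding M_def using m nonneg by (intro member_le_sum) auto
      moreover have "u n \<le> real (n div m) * u m + u (n mod m)"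
        using mult[of "n div m" m "n mod m"] by simp
      moreover have "real (n div m) * u m \<le> real n / real m * u m"
        using nonneg by (intro mult_right_mono of_nat_div_le_of_nat)
      ultimately have "u n \<le> real n / real m * u m + M"
        by linarith
      then have "u n / real n \<le> (real n / real m * u m + M) / real n"
        by (intro divide_right_mono) auto
      also have "\<dots> = u m / real m + M / real n"
        using elim m by (simp add: field_simps)
      finally show ?case
        using elim by linarith
    qed
  qed
qed

text \<open>Bolzano--Weierstrass is applied to one index after another; since \<open>Q\<close> is
  finite, the repeated thinning comes to an end.\<close>

lemma finite_simultaneously_convergent_subseq:
  fixes g :: "'a \<Rightarrow> nat \<Rightarrow> real"
  assumes "finite Q" "\<And>x. x \<in> Q \<Longrightarrow> Bseq (g x)"
  obtains r where "strict_mono r" "\<And>x. x \<in> Q \<Longrightarrow> convergent (g x \<circ> r)"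
  using assms
proof (induction arbitrary: thesis)
  case empty
  show ?case
    by (rule empty(1)[of id]) (auto simp: strict_mono_def)
next
  case (insert x Q)
  obtain r where r: "strict_mono r" "\<And>y. y \<in> Q \<Longrightarrow> convergent (g y \<circ> r)"
    using insert by blast
  have "bounded (range (g x \<circ> r))"
    using insert.prems(2)[of x] by (auto simp: Bseq_eq_bounded elim!: bounded_subset)
  then obtain l q where q: "strict_mono q" "((g x \<circ> r) \<circ> q) \<longlonglongrightarrow> l"
    using bounded_imp_convergent_subsequence by blast
  show ?case
  proof (rule insert.prems(1)[of "r \<circ> q"])
    show "strict_mono (r \<circ> q)"
      using r q by (simp add: strict_mono_o)
    show "convergent (g y \<circ> (r \<circ> q))" if "y \<in> insert x Q" for y
      using that r(2)[of y] q convergent_subseq_convergent[OF _ q(1), of "g y \<circ> r"]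
      by (auto simp: o_assoc convergent_def)
  qed
qed

text \<open>The root test gives the generating function \<open>\<Sum>n. a n * t ^ n\<close> radius of convergence
  \<open>1 / s\<close>, and \<open>s ^ n \<le> a n\<close> makes it blow up as \<open>t\<close> increases to \<open>1 / s\<close>. So
  \<open>avg\<close> is a mean that forgets bounded perturbations, and in the limit a shift of the sequence
  is multiplication by \<open>s\<close>.\<close>

locale exponential_growth =
  fixes a :: "nat \<Rightarrow> real" and s :: real
  assumes s_gt_1: "1 < s"
    and power_le: "\<And>n. s ^ n \<le> a n"
    and rate: "(\<lambda>n. ln (a n) / real n) \<longlonglongrightarrow> ln s"
begin

definition t :: "nat \<Rightarrow> real" where
  "t k = (1 - 1 / real (k + 2)) / s"

definition W :: "nat \<Rightarrow> real" where
  "W k = (\<Sum>n. a n * t k ^ n)"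

definition avg :: "nat \<Rightarrow> (nat \<Rightarrow> real) \<Rightarrow> real" where
  "avg k u = (\<Sum>n. u n * t k ^ n) / W k"

section \<open>Convergence and size of the weighted series\<close>

lemma a_pos: "0 < a n"
proof -
  have "0 < s ^ n"
    using s_gt_1 by simp
  then show ?thesis
    using power_le[of n] by linarith
qed

lemma t_pos: "0 < t k"
proof -
  have "1 / real (k + 2) < 1"
    by simp
  then show ?thesis
    unfolding t_def using s_gt_1 by (intro divide_pos_pos) linarith+
qed

lemma t_less: "t k < 1 / s"
proof -
  have "0 < 1 / real (k + 2)"
    by simp
  then show ?thesis
    unfolding t_def using s_gt_1 by (intro divide_strict_right_mono) linarith+
qed

lemma t_less_1: "t k < 1"
proof -
  have "1 / s < 1"
    using s_gt_1 by simp
  then show ?thesis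
    using t_less[of k] by linarith
qed

lemma t_tendsto: "t \<longlonglongrightarrow> 1 / s"
proof -
  have "(\<lambda>k. (1 - 1 / real (k + 2)) / s) \<longlonglongrightarrow> (1 - 0) / s"
    using s_gt_1 LIMSEQ_ignore_initial_segment[OF lim_const_over_n[of 1], of 2]
    by (intro tendsto_divide tendsto_diff) auto
  then show ?thesis
    by (simp add: t_def[abs_def])
qed

text \<open>Root test: the rate puts \<open>a n\<close> eventually below \<open>r ^ n\<close> for
  some \<open>r\<close> strictly between \<open>s\<close> and \<open>1 / t k\<close>, which leaves a
  geometric series of ratio \<open>r * t k < 1\<close>.\<close>

lemma summable_a: "summable (\<lambda>n. a n * t k ^ n)"
proof -
  obtain r where r: "s < r" "r < 1 / t k"
    using dense[of s "1 / t k"] t_less[of k] t_pos[of k] s_gt_1 by (auto simp: field_simps)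
  have "\<forall>\<^sub>F n in sequentially. ln (a n) / real n < ln r"
    using r s_gt_1 by (intro order_tendstoD(2)[OF rate]) auto
  then have "\<forall>\<^sub>F n in sequentially. norm (a n * t k ^ n) \<le> (r * t k) ^ n"
    using eventually_ge_at_top[of 1]
  proof eventually_elim
    case (elim n)
    then have "ln (a n) < ln (r ^ n)"
      using r s_gt_1 by (simp add: ln_realpow field_simps)
    then have "a n < r ^ n"
      using a_pos r s_gt_1 by (subst (asm) ln_less_cancel_iff) auto
    then show ?case
      using a_pos[of n] t_pos[of k] by (simp add: power_mult_distrib abs_mult mult_right_mono)
  qed
  moreover have "summable (\<lambda>n. (r * t k) ^ n)"
    using r t_pos[of k] s_gt_1 by (intro summable_geometric) (simp add: field_simps abs_mult)
  ultimately show ?thesis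
    by (rule summable_comparison_test_ev)
qed

lemma summable_dominated:
  assumes "\<And>n. \<bar>u n\<bar> \<le> M * a n"
  shows "summable (\<lambda>n. u n * t k ^ n)"
proof (rule summable_comparison_test')
  show "summable (\<lambda>n. M * (a n * t k ^ n))"
    by (intro summable_mult summable_a)
  show "norm (u n * t k ^ n) \<le> M * (a n * t k ^ n)" if "n \<ge> 0" for n
    using mult_right_mono[OF assms[of n], of "t k ^ n"] t_pos[of k] by (simp add: abs_mult mult.assoc)
qed

text \<open>The lower bound on \<open>a n\<close> allows comparison with the geometric series of
  ratio \<open>s * t k = 1 - 1 / (k + 2)\<close>, whose sum is \<open>k + 2\<close>.\<close>

lemma W_ge: "real (k + 2) \<le> W k"
proof -
  have st: "s * t k = 1 - 1 / real (k + 2)"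
    using s_gt_1 by (simp add: t_def)
  have "norm (s * t k) < 1"
    unfolding st by simp
  then have "(\<lambda>n. (s * t k) ^ n) sums (1 / (1 - s * t k))"
    by (rule geometric_sums)
  moreover have "1 / (1 - s * t k) = real (k + 2)"
    unfolding st by simp
  ultimately have sums: "(\<lambda>n. (s * t k) ^ n) sums real (k + 2)"
    by simp
  have "(s * t k) ^ n \<le> a n * t k ^ n" for n
    using power_le[of n] t_pos[of k] by (simp add: power_mult_distrib mult_right_mono)
  then show ?thesis
    unfolding W_def using sums summable_sums[OF summable_a[of k]] by (rule sums_le)
qed

lemma W_pos: "0 < W k"
  using W_ge[of k] by linarith

lemma inverse_W_tendsto: "(\<lambda>k. M / W k) \<longlonglongrightarrow> 0"
proof (rule Lim_null_comparison)
  show "\<forall>\<^sub>F k in sequentially. norm (M / W k) \<le> \<bar>M\<bar> / real (k + 2)"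
    using W_ge W_pos by (intro always_eventually allI) (auto intro!: divide_left_mono mult_pos_pos simp: abs_of_pos)
  show "(\<lambda>k. \<bar>M\<bar> / real (k + 2)) \<longlonglongrightarrow> 0"
    by (rule LIMSEQ_ignore_initial_segment[OF lim_const_over_n])
qed

text \<open>Since \<open>t k\<close> stays below \<open>1 / s < 1\<close>, the numerator is bounded
  uniformly in \<open>k\<close>, while \<open>W k\<close> tends to infinity.\<close>

lemma avg_bounded_tendsto:
  assumes "\<And>n. \<bar>u n\<bar> \<le> M"
  shows "(\<lambda>k. avg k u) \<longlonglongrightarrow> 0"
proof (rule Lim_null_comparison)
  have "norm (avg k u) \<le> M / (1 - 1 / s) / W k" for k
  proof -
    have geo: "(\<lambda>n. t k ^ n) sums (1 / (1 - t k))"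
      using t_pos[of k] t_less_1[of k] by (intro geometric_sums) auto
    have "norm (u n * t k ^ n) \<le> M * t k ^ n" for n
      using assms[of n] t_pos[of k] by (simp add: abs_mult mult_right_mono)
    then have "norm (\<Sum>n. u n * t k ^ n) \<le> (\<Sum>n. M * t k ^ n)"
      using summable_mult[OF sums_summable[OF geo]] by (rule norm_suminf_le)
    also have "\<dots> = M * (1 / (1 - t k))"
      using geo by (simp add: suminf_mult sums_summable sums_iff)
    also have "\<dots> \<le> M * (1 / (1 - 1 / s))"
      using assms[of 0] t_less[of k] t_less_1[of k] s_gt_1
      by (intro mult_left_mono divide_left_mono mult_pos_pos) auto
    finally show ?thesis
      using W_pos[of k] by (simp add: avg_def divide_right_mono del: divide_divide_eq_left)
  qed
  then show "\<forall>\<^sub>F k in sequentially. norm (avg k u) \<le> M / (1 - 1 / s) / W k"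
    by simp
qed (rule inverse_W_tendsto)

lemma avg_diff:
  assumes "\<And>n. \<bar>u n\<bar> \<le> M * a n" "\<And>n. \<bar>v n\<bar> \<le> M' * a n"
  shows "avg k (\<lambda>n. u n - v n) = avg k u - avg k v"
  using suminf_diff[OF summable_dominated[of u M k] summable_dominated[of v M' k]] assms
  by (simp add: avg_def left_diff_distrib flip: diff_divide_distrib)

lemma avg_mono:
  assumes "\<And>n. \<bar>u n\<bar> \<le> M * a n" "\<And>n. \<bar>v n\<bar> \<le> M' * a n" "\<And>n. u n \<le> v n"
  shows "avg k u \<le> avg k v"
  unfolding avg_def using assms t_pos[of k] W_pos[of k]
  by (intro divide_right_mono suminf_le summable_dominated) (auto intro!: mult_right_mono)

lemma avg_a: "avg k a = 1"
  using W_pos[of k] by (simp add: avg_def W_def)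

text \<open>The term of index 0 is split off and a factor \<open>t k\<close> is taken out of the
  rest. As \<open>k\<close> grows, the first summand vanishes and the factor tends to
  \<open>1 / s\<close>.\<close>

lemma avg_shift:
  assumes "\<And>n. \<bar>u n\<bar> \<le> M * a n"
  shows "avg k u = u 0 / W k + t k * avg k (\<lambda>n. u (Suc n))"
proof -
  have "summable (\<lambda>n. u (Suc n) * t k ^ n)"
    using summable_Suc_iff[of "\<lambda>n. u n * t k ^ n"] summable_dominated[OF assms, of k]
      summable_mult[of "\<lambda>n. u (Suc n) * t k ^ Suc n" "1 / t k"] t_pos[of k]
    by (simp add: field_simps)
  then have "(\<Sum>n. u (Suc n) * t k ^ Suc n) = t k * (\<Sum>n. u (Suc n) * t k ^ n)"
    by (subst suminf_mult[symmetric]) (auto simp: algebra_simps)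
  then have "(\<Sum>n. u n * t k ^ n) = u 0 + t k * (\<Sum>n. u (Suc n) * t k ^ n)"
    using suminf_split_head[OF summable_dominated[OF assms, of k]] by simp
  then show ?thesis
    by (simp only: avg_def add_divide_distrib times_divide_eq_right)
qed

text \<open>\<open>H x\<close> is the limit of the means of \<open>u x\<close> along a subsequence
  common to all of \<open>Q\<close>. Bounded errors disappear in this limit, which gives the values
  0 and 1; in the last property the shift by one step produces the factor \<open>s\<close>.\<close>

lemma growth_weights:
  fixes u :: "'b \<Rightarrow> nat \<Rightarrow> real"
  assumes fin: "finite Q" and u: "\<And>x n. x \<in> Q \<Longrightarrow> 0 \<le> u x n \<and> u x n \<le> a n"
  obtains H where
    "\<And>x. x \<in> Q \<Longrightarrow> 0 \<le> H x \<and> H x \<le> 1"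
    "\<And>x y. x \<in> Q \<Longrightarrow> y \<in> Q \<Longrightarrow> (\<And>n. u x n \<le> u y n) \<Longrightarrow> H x \<le> H y"
    "\<And>x M. x \<in> Q \<Longrightarrow> (\<And>n. u x n \<le> M) \<Longrightarrow> H x = 0"
    "\<And>x M. x \<in> Q \<Longrightarrow> (\<And>n. a n \<le> u x n + M) \<Longrightarrow> H x = 1"
    "\<And>w x y z M. {w, x, y, z} \<subseteq> Q \<Longrightarrow>
       (\<And>n. \<bar>(u z n - u y n) - (u x (Suc n) - u w (Suc n))\<bar> \<le> M) \<Longrightarrow> H z - H y = s * (H x - H w)"
proof -
  have dom: "\<bar>u x n\<bar> \<le> 1 * a n" if "x \<in> Q" for x n
    using u[OF that, of n] by simp
  have doma: "\<bar>a n\<bar> \<le> 1 * a n" for n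
    using a_pos[of n] by simp
  have dom0: "\<bar>0\<bar> \<le> 0 * a n" for n
    by simp
  have avg01: "0 \<le> avg k (u x)" "avg k (u x) \<le> 1" if x: "x \<in> Q" for x k
    using avg_mono[OF dom0 dom[OF x], of k] avg_mono[OF dom[OF x] doma, of k] u[OF x] avg_a[of k]
    by (simp_all add: avg_def)
  have "Bseq (\<lambda>k. avg k (u x))" if "x \<in> Q" for x
    using avg01[OF that] by (intro BseqI'[of _ 1]) auto
  then obtain r where r: "strict_mono r" "\<And>x. x \<in> Q \<Longrightarrow> convergent ((\<lambda>k. avg k (u x)) \<circ> r)"
    using finite_simultaneously_convergent_subseq[OF fin, of "\<lambda>x k. avg k (u x)"] by blast
  define H where "H x = lim ((\<lambda>k. avg k (u x)) \<circ> r)" for x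
  have H: "(\<lambda>k. avg (r k) (u x)) \<longlonglongrightarrow> H x" if "x \<in> Q" for x
    using r(2)[OF that] by (simp add: H_def convergent_LIMSEQ_iff o_def)
  have sub: "(\<lambda>k. X (r k)) \<longlonglongrightarrow> l" if "X \<longlonglongrightarrow> l" for X :: "nat \<Rightarrow> real" and l
    using LIMSEQ_subseq_LIMSEQ[OF that r(1)] by (simp add: o_def)
  show thesis
  proof
    show "0 \<le> H x \<and> H x \<le> 1" if "x \<in> Q" for x
      using LIMSEQ_le_const[OF H[OF that], of 0] LIMSEQ_le_const2[OF H[OF that], of 1] avg01[OF that] by blast
    show "H x \<le> H y" if "x \<in> Q" "y \<in> Q" "\<And>n. u x n \<le> u y n" for x y
      using that avg_mono[OF dom[OF that(1)] dom[OF that(2)]] by (intro LIMSEQ_le[OF H H]) auto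
    show "H x = 0" if x: "x \<in> Q" and M: "\<And>n. u x n \<le> M" for x M
    proof -
      have "(\<lambda>k. avg k (u x)) \<longlonglongrightarrow> 0"
        using M u[OF x] by (intro avg_bounded_tendsto[of _ M]) auto
      then show ?thesis
        using LIMSEQ_unique[OF H[OF x]] sub by blast
    qed
    show "H x = 1" if x: "x \<in> Q" and M: "\<And>n. a n \<le> u x n + M" for x M
    proof -
      have "\<bar>a n - u x n\<bar> \<le> M" for n
        using M[of n] u[OF x, of n] by linarith
      then have "(\<lambda>k. avg k (\<lambda>n. a n - u x n)) \<longlonglongrightarrow> 0"
        by (rule avg_bounded_tendsto)
      then have "(\<lambda>k. 1 - avg (r k) (u x)) \<longlonglongrightarrow> 0"
        using sub[of "\<lambda>k. avg k (\<lambda>n. a n - u x n)"] by (simp add: avg_diff[OF doma dom[OF x]] avg_a)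
      then show ?thesis
        using LIMSEQ_unique tendsto_diff[OF tendsto_const[of 1] H[OF x]] by fastforce
    qed
    show "H z - H y = s * (H x - H w)"
      if Q: "{w, x, y, z} \<subseteq> Q"
        and M: "\<And>n. \<bar>(u z n - u y n) - (u x (Suc n) - u w (Suc n))\<bar> \<le> M" for w x y z M
    proof -
      let ?d = "\<lambda>n. u x (Suc n) - u w (Suc n)" and ?e = "\<lambda>n. u z n - u y n"
      have dxw: "\<bar>u x n - u w n\<bar> \<le> 1 * a n" and dzy: "\<bar>?e n\<bar> \<le> 1 * a n" for n
        using u[of x n] u[of y n] u[of z n] u[of w n] Q by auto
      \<comment> \<open>The shifted sequences are not known to be dominated by a multiple of
        \<open>a\<close>, but their difference is within \<open>M\<close> of \<open>?e n\<close>,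
        and \<open>1 \<le> a n\<close>.\<close>
      have "\<bar>?d n\<bar> \<le> (1 + M) * a n" for n
      proof -
        have "1 * 1 \<le> s ^ n"
          using s_gt_1 by simp
        then have "M * 1 \<le> M * a n"
          using power_le[of n] M[of n] by (intro mult_left_mono) linarith+
        then show ?thesis
          using M[of n] dzy[of n] by (simp add: algebra_simps)
      qed
      note dd = this
      have lim_e: "(\<lambda>k. avg (r k) (u z) - avg (r k) (u y)) \<longlonglongrightarrow> H z - H y"
        using Q by (intro tendsto_diff H) auto
      have lim_d: "(\<lambda>k. avg (r k) (u x) - avg (r k) (u w)) \<longlonglongrightarrow> H x - H w"
        using Q by (intro tendsto_diff H) auto
      have "(\<lambda>k. avg k (\<lambda>n. ?e n - ?d n)) \<longlonglongrightarrow> 0"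
        using M by (rule avg_bounded_tendsto)
      then have err: "(\<lambda>k. avg (r k) (\<lambda>n. ?e n - ?d n)) \<longlonglongrightarrow> 0"
        by (rule sub)
      \<comment> \<open>This is \<open>avg_shift\<close> for the difference of \<open>u x\<close>
        and \<open>u w\<close>, with the shifted difference \<open>?d\<close> written as
        \<open>?e\<close> minus the bounded error \<open>?e - ?d\<close>.\<close>
      have "avg k (u x) - avg k (u w) =
          (u x 0 - u w 0) / W k + t k * (avg k (u z) - avg k (u y) - avg k (\<lambda>n. ?e n - ?d n))" for k
        using avg_shift[OF dxw, of k] avg_diff[OF dzy dd, of k] Q
          avg_diff[OF dom[of x] dom[of w], of k] avg_diff[OF dom[of z] dom[of y], of k]
        by simp
      then have "(\<lambda>k. avg (r k) (u x) - avg (r k) (u w)) \<longlonglongrightarrow> 0 + 1 / s * (H z - H y - 0)"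
        by (simp only:) (intro tendsto_add tendsto_mult tendsto_diff sub[OF inverse_W_tendsto]
            sub[OF t_tendsto] err lim_e[unfolded tendsto_diff])
      then have "H x - H w = 1 / s * (H z - H y)"
        using LIMSEQ_unique[OF lim_d] by simp
      then show ?thesis
        using s_gt_1 by (simp add: field_simps)
    qed
  qed
qed

end

section \<open>Precritical points\<close>

locale unimodal_with_turning_point =
  fixes f :: "real \<Rightarrow> real" and c :: real
  assumes cont: "continuous_on {0..1} f"
    and maps: "\<And>x. x \<in> {0..1} \<Longrightarrow> f x \<in> {0..1}"
    and turning: "turning_point f c"
begin

text \<open>The elements strictly between 0 and 1 are the turning points of \<open>f ^^ n\<close>.
  The endpoints 0 and 1 may belong to the set too.\<close>

definition precritical :: "nat \<Rightarrow> real set" where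
  "precritical n = {x \<in> {0..1}. \<exists>j<n. (f ^^ j) x = c}"

lemma c_bounds: "0 < c" "c < 1"
  using turning by (auto simp: turning_point_def)

lemma maps_funpow: "x \<in> {0..1} \<Longrightarrow> (f ^^ n) x \<in> {0..1}"
  by (induction n) (use maps in auto)

lemma precritical_0: "precritical 0 = {}"
  by (simp add: precritical_def)

lemma precritical_Suc: "precritical (Suc n) = {x \<in> {0..1}. x = c \<or> f x \<in> precritical n}"
  using maps by (auto simp: precritical_def Ex_less_Suc2 funpow_swap1)

lemma precritical_subset: "precritical n \<subseteq> {0..1}"
  by (auto simp: precritical_def)

lemma precritical_add:
  "precritical (m + n) = precritical m \<union> {x \<in> {0..1}. (f ^^ m) x \<in> precritical n}"
proof (induction m)
  case 0
  then show ?case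
    using precritical_subset[of n] by (auto simp: precritical_0)
next
  case (Suc m)
  have "precritical (Suc m + n) = {x \<in> {0..1}. x = c \<or> f x \<in> precritical (m + n)}"
    by (simp add: precritical_Suc)
  also have "\<dots> = precritical (Suc m) \<union> {x \<in> {0..1}. (f ^^ Suc m) x \<in> precritical n}"
    unfolding Suc precritical_Suc using maps by (auto simp: funpow_swap1)
  finally show ?case .
qed

section \<open>Monotonicity and turning points of the iterates\<close>

lemma strictly_monotonic_left: "strictly_monotonic_on {0..c} f"
  and strictly_monotonic_right: "strictly_monotonic_on {c..1} f"
  using turning by (auto simp: turning_point_def)

lemma strictly_monotonic_off_c:
  assumes "0 \<le> x" "y \<le> 1" "c \<notin> {x<..<y}"
  shows "strictly_monotonic_on {x..y} f"
proof (cases "y \<le> c")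
  case True
  then show ?thesis
    using assms by (intro strictly_monotonic_on_subset[OF strictly_monotonic_left]) auto
next
  case False
  then show ?thesis
    using assms by (intro strictly_monotonic_on_subset[OF strictly_monotonic_right]) auto
qed

lemma image_off_c:
  assumes "0 \<le> x" "x \<le> y" "y \<le> 1" "c \<notin> {x<..<y}"
  shows "f ` {x..y} = {min (f x) (f y)..max (f x) (f y)}"
  using assms
  by (intro image_Icc_strictly_monotonic strictly_monotonic_off_c continuous_on_subset[OF cont]) auto

text \<open>\<open>f\<close> is injective on each side of \<open>c\<close>, so every point has at
  most one preimage per side: one more step at most doubles the count and adds 1 for
  \<open>c\<close> itself.\<close>

lemma finite_card_precritical:
  "finite (precritical n) \<and> card (precritical n) + 1 \<le> 2 ^ n"
proof (induction n)
  case (Suc n)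
  let ?L = "f -` precritical n \<inter> {0..c}" and ?R = "f -` precritical n \<inter> {c..1}"
  have injL: "inj_on f {0..c}" and injR: "inj_on f {c..1}"
    using strictly_monotonic_left strictly_monotonic_right strictly_monotonic_imp_inj_on by blast+
  have "finite ?L" "finite ?R"
    using Suc injL injR by (auto intro: finite_vimage_IntI)
  then have "card (insert c (?L \<union> ?R)) \<le> Suc (card ?L + card ?R)"
    using card_Un_le[of ?L ?R] by (simp add: card_insert_if)
  moreover have "card ?L \<le> card (precritical n)" "card ?R \<le> card (precritical n)"
    using Suc injL injR by (auto intro: card_vimage_inj_on_le)
  moreover have sub: "precritical (Suc n) \<subseteq> insert c (?L \<union> ?R)"
    by (auto simp: precritical_Suc)
  ultimately show ?case
    using Suc \<open>finite ?L\<close> \<open>finite ?R\<close> finite_subset[OF sub] card_mono[OF _ sub] by auto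
qed (simp add: precritical_0)

lemmas finite_precritical = finite_card_precritical[THEN conjunct1]

text \<open>\<open>f\<close> is strictly monotone on the interval and maps it onto an interval. A
  point of \<open>precritical n\<close> inside the image would pull back to a point of
  \<open>precritical (Suc n)\<close> inside the original interval, so the induction hypothesis
  applies to the image.\<close>

lemma strictly_monotonic_funpow:
  assumes "0 \<le> x" "x \<le> y" "y \<le> 1" "precritical n \<inter> {x<..<y} = {}"
  shows "strictly_monotonic_on {x..y} (f ^^ n)"
  using assms
proof (induction n arbitrary: x y)
  case 0
  then show ?case
    by (auto simp: monotone_on_def)
next
  case (Suc n)
  have c: "c \<notin> {x<..<y}"
  proof -
    have "c \<in> precritical (Suc n)"
      using c_bounds by (simp add: precritical_Suc)
    then show ?thesis
      using Suc.prems(4) by blast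
  qed
  have f: "strictly_monotonic_on {x..y} f"
    using Suc.prems c by (intro strictly_monotonic_off_c)
  have im: "f ` {x..y} = {min (f x) (f y)..max (f x) (f y)}"
    using Suc.prems c by (intro image_off_c)
  have "precritical n \<inter> {min (f x) (f y)<..<max (f x) (f y)} = {}"
  proof -
    have False if v: "v \<in> precritical n" "min (f x) (f y) < v" "v < max (f x) (f y)" for v
    proof -
      have "v \<in> f ` {x..y}"
        unfolding im using v by simp
      then obtain u where u: "u \<in> {x..y}" "v = f u"
        by blast
      moreover have "u \<noteq> x" "u \<noteq> y"
        using v u by (auto simp: min_def max_def split: if_splits)
      ultimately have "u \<in> precritical (Suc n) \<inter> {x<..<y}"
        using v(1) Suc.prems(1,3) by (auto simp: precritical_Suc order_less_le)
      then show False
        using Suc.prems by blast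
    qed
    then show ?thesis
      by fastforce
  qed
  moreover have "0 \<le> min (f x) (f y)" "max (f x) (f y) \<le> 1"
    using maps[of x] maps[of y] Suc.prems by auto
  ultimately have "strictly_monotonic_on (f ` {x..y}) (f ^^ n)"
    unfolding im by (intro Suc.IH) auto
  then show ?case
    using strictly_monotonic_on_comp[OF f] by (simp only: funpow_Suc_right)
qed

lemma funpow_not_constant:
  assumes "0 \<le> x" "x < y" "y \<le> 1"
  shows "\<exists>u\<in>{x..y}. \<exists>v\<in>{x..y}. (f ^^ n) u \<noteq> (f ^^ n) v"
proof -
  \<comment> \<open>\<open>z\<close> is the first precritical point to the right of
    \<open>x\<close>, cut off at \<open>y\<close>; up to there the iterate is injective.\<close>
  obtain z where z: "x < z" "z \<le> y" "precritical n \<inter> {x<..<z} = {}"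
  proof
    let ?S = "insert y {u \<in> precritical n. x < u}"
    have fin: "finite ?S"
      using finite_precritical by simp
    show "x < min y (Min ?S)"
      using fin assms by auto
    show "min y (Min ?S) \<le> y"
      by simp
    show "precritical n \<inter> {x<..<min y (Min ?S)} = {}"
      using Min_le[OF fin] by fastforce
  qed
  then have "inj_on (f ^^ n) {x..z}"
    using assms by (intro strictly_monotonic_imp_inj_on strictly_monotonic_funpow) auto
  then have "(f ^^ n) x \<noteq> (f ^^ n) z"
    using z(1) by (auto dest: inj_onD)
  then show ?thesis
    using z assms by (intro bexI[of _ x] bexI[of _ z]) auto
qed

text \<open>Points with the same image on the two sides of \<open>c\<close> force a monotone iterate to be
  constant in between.\<close>

lemma fold_at_c:
  assumes "0 \<le> x" "x < c" "c < y" "y \<le> 1"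
  obtains u v where "x \<le> u" "u < c" "c < v" "v \<le> y" "f u = f v"
proof -
  have imL: "f ` {x..c} = {min (f x) (f c)..max (f x) (f c)}"
    using assms by (intro image_off_c) auto
  have imR: "f ` {c..y} = {min (f c) (f y)..max (f c) (f y)}"
    using assms by (intro image_off_c) auto
  have m: "x \<in> {0..c}" "c \<in> {0..c}" "c \<in> {c..1}" "y \<in> {c..1}"
    using assms by auto
  consider "f x < f c" "f y < f c" | "f c < f x" "f c < f y"
    using turning m assms(2,3) unfolding turning_point_def monotone_on_def by blast
  \<comment> \<open>Of the two endpoint values, the one closer to \<open>f c\<close> is attained on
    both sides.\<close>
  then have "\<exists>h. h \<noteq> f c \<and> h \<in> f ` {x..c} \<and> h \<in> f ` {c..y}"
  proof cases
    case 1
    then show ?thesis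
      unfolding imL imR by (intro exI[of _ "max (f x) (f y)"]) auto
  next
    case 2
    then show ?thesis
      unfolding imL imR by (intro exI[of _ "min (f x) (f y)"]) auto
  qed
  then obtain u v where "u \<in> {x..c}" "v \<in> {c..y}" "f u = f v" "f u \<noteq> f c"
    by auto
  then show ?thesis
    using that[of u v] by (auto simp: order_le_less)
qed

text \<open>If \<open>z = c\<close>, the fold would force a monotone iterate to be constant on an
  interval. Otherwise \<open>f\<close> is strictly monotone on an interval around \<open>z\<close>
  that stays on one side of \<open>c\<close>, and the claim passes to \<open>f z\<close>, which
  meets \<open>c\<close> one step earlier.\<close>

lemma not_monotonic_funpow:
  assumes "0 \<le> x" "x < z" "z < y" "y \<le> 1" "z \<in> precritical n"
  shows "\<not> monotonic_on {x..y} (f ^^ n)"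
  using assms
proof (induction n arbitrary: x y z)
  case 0
  then show ?case
    by (simp add: precritical_0)
next
  case (Suc n)
  show ?case
  proof
    assume mono: "monotonic_on {x..y} (f ^^ Suc n)"
    show False
    proof (cases "z = c")
      case True
      then obtain u v where uv: "x \<le> u" "u < c" "c < v" "v \<le> y" "f u = f v"
        using fold_at_c[of x y] Suc.prems by auto
      then have eq: "(f ^^ Suc n) u = (f ^^ Suc n) v"
        by (simp add: funpow_swap1)
      have const: "(f ^^ Suc n) w = (f ^^ Suc n) u" if "w \<in> {u..v}" for w
      proof -
        have "u \<in> {x..y}" "w \<in> {x..y}" "v \<in> {x..y}" "u \<le> w" "w \<le> v"
          using that uv by auto
        then show ?thesis
          using mono eq unfolding monotone_on_def by (metis order_antisym)
      qed
      have "0 \<le> u" "u < v" "v \<le> 1"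
        using uv Suc.prems(1,4) by linarith+
      then obtain w w' where "w \<in> {u..v}" "w' \<in> {u..v}" "(f ^^ Suc n) w \<noteq> (f ^^ Suc n) w'"
        using funpow_not_constant by blast
      then show False
        using const[of w] const[of w'] by simp
    next
      case False
      \<comment> \<open>The interval is cut at \<open>c\<close>, keeping \<open>z\<close> in the
        interior.\<close>
      define x' where "x' = (if c < z then max x c else x)"
      define y' where "y' = (if z < c then min y c else y)"
      have xy': "x \<le> x'" "x' < z" "z < y'" "y' \<le> y" "c \<notin> {x'<..<y'}"
        using False Suc.prems by (auto simp: x'_def y'_def)
      have f: "strictly_monotonic_on {x'..y'} f"
        using Suc.prems xy' by (intro strictly_monotonic_off_c) auto
      have im: "f ` {x'..y'} = {min (f x') (f y')..max (f x') (f y')}"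
        using Suc.prems xy' by (intro image_off_c) auto
      have "monotonic_on {x'..y'} (f ^^ n \<circ> f)"
        using mono monotonic_on_subset[of "{x..y}" "f ^^ Suc n" "{x'..y'}"] xy'
        by (simp add: funpow_Suc_right del: funpow.simps)
      then have "monotonic_on {min (f x') (f y')..max (f x') (f y')} (f ^^ n)"
        using monotonic_on_comp_cancel[OF f] im by simp
      moreover have "min (f x') (f y') < f z" "f z < max (f x') (f y')"
        using interior_image_strictly_monotonic[OF f] xy' by auto
      moreover have "0 \<le> min (f x') (f y')" "max (f x') (f y') \<le> 1"
        using maps[of x'] maps[of y'] xy' Suc.prems by auto
      moreover have "f z \<in> precritical n"
        using Suc.prems False by (simp add: precritical_Suc)
      ultimately show False
        using Suc.IH by blast
    qed
  qed
qed

lemma card_branches_funpow: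
  "card (branches (f ^^ n)) = card (precritical n \<inter> {0<..<1}) + 1"
proof (rule card_branches)
  show "monotonic_on {x..y} (f ^^ n)"
    if "0 \<le> x" "x \<le> y" "y \<le> 1" "precritical n \<inter> {0<..<1} \<inter> {x<..<y} = {}" for x y
  proof -
    have "precritical n \<inter> {x<..<y} = {}"
      using that by fastforce
    then show ?thesis
      using that by (intro strictly_monotonic_imp_monotonic strictly_monotonic_funpow)
  qed
qed (use finite_precritical not_monotonic_funpow in auto)

text \<open>A point that meets \<open>c\<close> at time \<open>m\<close> or later, but not before,
  is determined by the lap of \<open>f ^^ m\<close> containing it and by its image under
  \<open>f ^^ m\<close>, which lies in \<open>precritical n\<close>. The added 1 accounts for the
  lap starting at 0.\<close>

lemma precritical_submult:
  "card (precritical (m + n)) + 1 \<le> (card (precritical m) + 1) * (card (precritical n) + 1)"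
proof -
  define N where "N = precritical (m + n) - precritical m"
  \<comment> \<open>The left end of the lap containing \<open>x\<close>.\<close>
  define p where "p x = Max {q \<in> insert 0 (precritical m). q \<le> x}" for x
  let ?g = "\<lambda>x. (p x, (f ^^ m) x)"
  have p: "p x \<in> insert 0 (precritical m)" "p x \<le> x"
    and p_max: "q \<in> precritical m \<Longrightarrow> q \<le> x \<Longrightarrow> q \<le> p x" if "x \<in> N" for x q
  proof -
    let ?S = "{q \<in> insert 0 (precritical m). q \<le> x}"
    have fin: "finite ?S"
      using finite_precritical by simp
    have "0 \<in> ?S"
      using that precritical_subset[of "m + n"] by (auto simp: N_def)
    then have "p x \<in> ?S"
      unfolding p_def using Max_in[OF fin] by blast
    then show "p x \<in> insert 0 (precritical m)" "p x \<le> x"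
      by auto
    show "q \<in> precritical m \<Longrightarrow> q \<le> x \<Longrightarrow> q \<le> p x"
      unfolding p_def using fin by (intro Max_ge) auto
  qed
  have "inj_on ?g N"
  proof (rule linorder_inj_onI)
    fix x y assume xy: "x < y" "x \<in> N" "y \<in> N"
    show "?g x \<noteq> ?g y"
    proof (cases "p x = p y")
      case True
      have "precritical m \<inter> {x<..<y} = {}"
        using p_max[OF xy(3)] p[OF xy(2)] True by force
      moreover have "0 \<le> x" "y \<le> 1"
        using xy precritical_subset[of "m + n"] by (auto simp: N_def)
      ultimately have "inj_on (f ^^ m) {x..y}"
        using xy by (intro strictly_monotonic_imp_inj_on strictly_monotonic_funpow) auto
      then show ?thesis
        using xy(1) by (auto dest: inj_onD)
    qed simp
  qed auto
  moreover have "?g ` N \<subseteq> insert 0 (precritical m) \<times> precritical n"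
    using p by (auto simp: N_def precritical_add)
  ultimately have "card N \<le> card (insert 0 (precritical m) \<times> precritical n)"
    using finite_precritical by (intro card_inj_on_le) auto
  also have "\<dots> \<le> (card (precritical m) + 1) * card (precritical n)"
    unfolding card_cartesian_product using finite_precritical
    by (intro mult_right_mono) (auto simp: card_insert_if)
  finally have "card N \<le> (card (precritical m) + 1) * card (precritical n)" .
  moreover have "card (precritical (m + n)) \<le> card (precritical m) + card N"
    using card_Un_le[of "precritical m" N] finite_precritical
    by (auto simp: N_def precritical_add Un_commute card_mono intro: order_trans[OF card_mono])
  ultimately show ?thesis
    by (simp add: algebra_simps)
qed

end

section \<open>Entropy and the semiconjugacy to a tent map\<close>

context unimodal_with_turning_point
begin

text \<open>Adding 1 makes the count submultiplicative and comparable to the number of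
  branches.\<close>

definition growth :: "nat \<Rightarrow> real" where
  "growth n = real (card (precritical n) + 1)"

text \<open>The counting function whose weighted mean over \<open>n\<close> approximates the
  semiconjugacy at \<open>x\<close>.\<close>

definition height :: "real \<Rightarrow> nat \<Rightarrow> real" where
  "height x n = real (card (precritical n \<inter> {0..x}))"

lemma growth_ge_1: "1 \<le> growth n"
  by (simp add: growth_def)

text \<open>Only 0 and 1 can be precritical without being turning points, so \<open>growth n\<close>
  exceeds the number of laps by at most 2, and there is at least one lap.\<close>

lemma growth_le_laps: "growth n \<le> 3 * real (card (branches (f ^^ n)))"
proof -
  have "precritical n \<subseteq> precritical n \<inter> {0<..<1} \<union> {0, 1}"
    using precritical_subset[of n] by fastforce
  then have "card (precritical n) \<le> card (precritical n \<inter> {0<..<1} \<union> {0, 1})"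
    using finite_precritical[of n] by (intro card_mono) auto
  also have "\<dots> \<le> card (precritical n \<inter> {0<..<1}) + card {0, 1 :: real}"
    by (rule card_Un_le)
  finally show ?thesis
    by (simp add: growth_def card_branches_funpow)
qed

lemma laps_le_growth: "real (card (branches (f ^^ n))) \<le> growth n"
  using finite_precritical by (auto simp: growth_def card_branches_funpow intro: card_mono)

lemma laps_ge_1: "1 \<le> real (card (branches (f ^^ n)))"
  by (simp add: card_branches_funpow)

text \<open>Fekete's lemma for \<open>ln (growth n)\<close> gives a limit that is also a lower
  bound. The number of laps differs from \<open>growth n\<close> by a factor of at most 3, so the
  \<open>lim\<close> in \<open>h_top\<close> is a genuine limit with the same value.\<close>

lemma growth_rate: "(\<lambda>n. ln (growth n) / real n) \<longlonglongrightarrow> h_top f"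
  and power_le_growth: "exp (h_top f) ^ n \<le> growth n"
proof -
  have "ln (growth (m + n)) \<le> ln (growth m) + ln (growth n)" for m n
  proof -
    have "growth (m + n) \<le> growth m * growth n"
      unfolding growth_def of_nat_mult[symmetric] of_nat_le_iff by (rule precritical_submult)
    then have "ln (growth (m + n)) \<le> ln (growth m * growth n)"
      using growth_ge_1[of "m + n"] by (intro ln_mono) auto
    also have "\<dots> = ln (growth m) + ln (growth n)"
      using growth_ge_1[of m] growth_ge_1[of n] by (intro ln_mult_pos) auto
    finally show ?thesis .
  qed
  then obtain L where L: "(\<lambda>n. ln (growth n) / real n) \<longlonglongrightarrow> L" "\<And>n. real n * L \<le> ln (growth n)"
    using fekete[of "\<lambda>n. ln (growth n)"] growth_ge_1 by auto
  have "(\<lambda>n. ln (growth n) / real n - ln 3 / real n) \<longlonglongrightarrow> L - 0"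
    by (intro tendsto_diff L lim_const_over_n)
  then have lower: "(\<lambda>n. ln (growth n) / real n - ln 3 / real n) \<longlonglongrightarrow> L"
    by simp
  have "(\<lambda>n. 1 / real n * ln (real (card (branches (f ^^ n))))) \<longlonglongrightarrow> L"
  proof (rule tendsto_sandwich[OF _ _ lower L(1)]; intro always_eventually allI)
    fix n
    have "ln (growth n) \<le> ln (3 * real (card (branches (f ^^ n))))"
      using growth_ge_1[of n] growth_le_laps[of n] by (intro ln_mono) auto
    also have "\<dots> = ln 3 + ln (real (card (branches (f ^^ n))))"
      using laps_ge_1[of n] by (intro ln_mult_pos) auto
    finally have "(ln (growth n) - ln 3) / real n \<le> ln (real (card (branches (f ^^ n)))) / real n"
      by (intro divide_right_mono) auto
    then show "ln (growth n) / real n - ln 3 / real n \<le> 1 / real n * ln (real (card (branches (f ^^ n))))"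
      by (simp add: diff_divide_distrib)
    have "ln (real (card (branches (f ^^ n)))) \<le> ln (growth n)"
      using laps_ge_1[of n] laps_le_growth[of n] by (intro ln_mono) auto
    then show "1 / real n * ln (real (card (branches (f ^^ n)))) \<le> ln (growth n) / real n"
      by (simp add: divide_right_mono)
  qed
  then have h: "h_top f = L"
    unfolding h_top_def by (rule limI)
  show "(\<lambda>n. ln (growth n) / real n) \<longlonglongrightarrow> h_top f"
    using L h by simp
  show "exp (h_top f) ^ n \<le> growth n"
  proof -
    have "exp (h_top f) ^ n = exp (real n * L)"
      by (simp add: h exp_of_nat_mult)
    also have "\<dots> \<le> exp (ln (growth n))"
      using L(2) by simp
    also have "\<dots> = growth n"
      using growth_ge_1[of n] by simp
    finally show ?thesis .
  qed
qed

lemma exp_h_top_bounds: "1 \<le> exp (h_top f)" "exp (h_top f) \<le> 2"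
proof -
  have "0 \<le> h_top f"
    using growth_ge_1 by (intro LIMSEQ_le_const[OF growth_rate]) auto
  then show "1 \<le> exp (h_top f)"
    by simp
  have "growth 1 \<le> 2"
    using finite_card_precritical[of 1] by (simp add: growth_def)
  then show "exp (h_top f) \<le> 2"
    using power_le_growth[of 1] by simp
qed

section \<open>Heights and their behaviour under the map\<close>

lemma height_split:
  assumes "0 \<le> x" "x \<le> y"
  shows "\<bar>(height y n - height x n) - real (card (precritical n \<inter> {x..y}))\<bar> \<le> 1"
proof -
  let ?A = "precritical n \<inter> {0..x}" and ?B = "precritical n \<inter> {x..y}"
  have "?A \<union> ?B = precritical n \<inter> {0..y}" "?A \<inter> ?B \<subseteq> {x}"
    using assms by auto
  \<comment> \<open>Only \<open>x\<close> can be counted twice, hence the error 1.\<close>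
  moreover have "card (?A \<inter> ?B) \<le> card {x}"
    by (intro card_mono) (use \<open>?A \<inter> ?B \<subseteq> {x}\<close> in auto)
  ultimately show ?thesis
    using card_Un_Int[of ?A ?B] finite_precritical by (simp add: height_def)
qed

text \<open>Apart possibly from \<open>c\<close>, the points of \<open>precritical (Suc n)\<close>
  in \<open>{x..y}\<close> correspond bijectively under \<open>f\<close> to the points of
  \<open>precritical n\<close> in the image. The error 3 consists of 1 for \<open>c\<close> and 1
  for each of two uses of \<open>height_split\<close>.\<close>

lemma height_image:
  assumes "0 \<le> x" "x \<le> y" "y \<le> 1" "c \<notin> {x<..<y}"
  shows "\<bar>(height (max (f x) (f y)) n - height (min (f x) (f y)) n) -
           (height y (Suc n) - height x (Suc n))\<bar> \<le> 3"
proof -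
  let ?P = "{z \<in> {x..y}. f z \<in> precritical n}"
  let ?I = "{min (f x) (f y)..max (f x) (f y)}"
  have inj: "inj_on f ?P"
    using strictly_monotonic_off_c[OF assms(1,3,4)]
    by (intro inj_on_subset[OF strictly_monotonic_imp_inj_on[of "{x..y}"]]) auto
  have "f ` ?P = precritical n \<inter> f ` {x..y}"
    by auto
  then have im: "f ` ?P = precritical n \<inter> ?I"
    unfolding image_off_c[OF assms] .
  have card_P: "card ?P = card (precritical n \<inter> ?I)"
    using card_image[OF inj] im by simp
  have fin: "finite ?P"
    using finite_imageD[OF _ inj] im finite_precritical by simp
  have "?P \<subseteq> precritical (Suc n) \<inter> {x..y}" "precritical (Suc n) \<inter> {x..y} \<subseteq> insert c ?P"
    using assms by (auto simp: precritical_Suc)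
  then have "card ?P \<le> card (precritical (Suc n) \<inter> {x..y})"
      "card (precritical (Suc n) \<inter> {x..y}) \<le> card (insert c ?P)"
    using fin finite_precritical by (auto intro!: card_mono simp del: insert_Collect)
  moreover have "card (insert c ?P) \<le> card ?P + 1"
    using fin by (simp add: card_insert_if)
  ultimately have card_Suc: "card ?P \<le> card (precritical (Suc n) \<inter> {x..y})"
      "card (precritical (Suc n) \<inter> {x..y}) \<le> card ?P + 1"
    by linarith+
  have "0 \<le> min (f x) (f y)"
    using maps[of x] maps[of y] assms by auto
  then have "\<bar>(height (max (f x) (f y)) n - height (min (f x) (f y)) n) - real (card (precritical n \<inter> ?I))\<bar> \<le> 1"
    by (intro height_split) auto
  then show ?thesis
    using card_P card_Suc height_split[OF assms(1,2), of "Suc n"] by linarith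
qed

lemma turning_point_extremum:
  obtains (max) "\<And>x. x \<in> {0..1} \<Longrightarrow> f x \<le> f c"
    | (min) "\<And>x. x \<in> {0..1} \<Longrightarrow> f c \<le> f x"
  using turning unfolding turning_point_def
proof (elim conjE disjE)
  assume m: "strict_mono_on {0..c} f" "strict_antimono_on {c..1} f" and c: "0 < c" "c < 1"
  have "f x \<le> f c" if "x \<in> {0..1}" for x
  proof (cases x c rule: linorder_cases)
    case less
    then show ?thesis
      using that c monotone_onD[OF m(1), of x c] by auto
  next
    case greater
    then show ?thesis
      using that c monotone_onD[OF m(2), of c x] by auto
  qed simp
  then show thesis
    using that(1) by blast
next
  assume m: "strict_antimono_on {0..c} f" "strict_mono_on {c..1} f" and c: "0 < c" "c < 1"
  have "f c \<le> f x" if "x \<in> {0..1}" for x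
  proof (cases x c rule: linorder_cases)
    case less
    then show ?thesis
      using that c monotone_onD[OF m(1), of x c] by auto
  next
    case greater
    then show ?thesis
      using that c monotone_onD[OF m(2), of c x] by auto
  qed simp
  then show thesis
    using that(2) by blast
qed

text \<open>The weights \<open>H\<close> are the values of the Milnor--Thurston semiconjugacy to a map of constant
  slope, restricted to the finite set of points that matters.\<close>

lemma semiconjugacy_weights:
  assumes "1 < exp (h_top f)" and fin: "finite Q" and Q: "{0, 1, c} \<subseteq> Q" "Q \<subseteq> {0..1}"
  obtains H where "\<And>x. x \<in> Q \<Longrightarrow> 0 \<le> H x \<and> H x \<le> 1"
    "\<And>x y. x \<in> Q \<Longrightarrow> y \<in> Q \<Longrightarrow> x \<le> y \<Longrightarrow> H x \<le> H y"
    "H 0 = 0" "H 1 = 1"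
    "\<And>x. x \<in> Q \<Longrightarrow> f x \<in> Q \<Longrightarrow> f c \<in> Q \<Longrightarrow>
       H (max (f x) (f c)) - H (min (f x) (f c)) = exp (h_top f) * \<bar>H x - H c\<bar>"
proof -
  interpret exponential_growth growth "exp (h_top f)"
    using assms power_le_growth growth_rate by unfold_locales auto
  have dom: "0 \<le> height x n \<and> height x n \<le> growth n" for x n
    using card_mono[OF finite_precritical[of n], of "precritical n \<inter> {0..x}"]
    by (simp add: height_def growth_def)
  have mono: "height x n \<le> height y n" if "x \<le> y" for x y n
    unfolding height_def of_nat_le_iff using that finite_precritical by (intro card_mono) auto
  obtain H where H: "\<And>x. x \<in> Q \<Longrightarrow> 0 \<le> H x \<and> H x \<le> 1"
    "\<And>x y. x \<in> Q \<Longrightarrow> y \<in> Q \<Longrightarrow> (\<And>n. height x n \<le> height y n) \<Longrightarrow> H x \<le> H y"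
    "\<And>x M. x \<in> Q \<Longrightarrow> (\<And>n. height x n \<le> M) \<Longrightarrow> H x = 0"
    "\<And>x M. x \<in> Q \<Longrightarrow> (\<And>n. growth n \<le> height x n + M) \<Longrightarrow> H x = 1"
    "\<And>w x y z M. {w, x, y, z} \<subseteq> Q \<Longrightarrow>
       (\<And>n. \<bar>(height z n - height y n) - (height x (Suc n) - height w (Suc n))\<bar> \<le> M) \<Longrightarrow>
       H z - H y = exp (h_top f) * (H x - H w)"
    using growth_weights[OF fin, of height] dom by blast
  have H_mono: "H x \<le> H y" if "x \<in> Q" "y \<in> Q" "x \<le> y" for x y
    using H(2) that mono by blast
  show thesis
  proof (rule that[OF H(1) H_mono])
    have "height 0 n \<le> 1" for n
      using card_mono[of "{0 :: real}" "precritical n \<inter> {0}"] by (simp add: height_def)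
    then show "H 0 = 0"
      using H(3)[of 0 1] Q by simp
    have "growth n \<le> height 1 n + 1" for n
      using precritical_subset[of n] by (simp add: height_def growth_def Int_absorb2)
    then show "H 1 = 1"
      using H(4)[of 1 1] Q by simp
    show "H (max (f x) (f c)) - H (min (f x) (f c)) = exp (h_top f) * \<bar>H x - H c\<bar>"
      if x: "x \<in> Q" "f x \<in> Q" "f c \<in> Q" for x
    proof (cases "x \<le> c")
      case True
      have "{x, c, min (f x) (f c), max (f x) (f c)} \<subseteq> Q"
        using x Q by (auto simp: min_def max_def)
      moreover have "0 \<le> x"
        using x Q by auto
      ultimately have "H (max (f x) (f c)) - H (min (f x) (f c)) = exp (h_top f) * (H c - H x)"
        using True c_bounds by (intro H(5)[where M = 3] height_image) auto
      then show ?thesis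
        using H_mono[OF x(1) _ True] Q by simp
    next
      case False
      have "{c, x, min (f c) (f x), max (f c) (f x)} \<subseteq> Q"
        using x Q by (auto simp: min_def max_def)
      moreover have "x \<le> 1"
        using x Q by auto
      ultimately have "H (max (f c) (f x)) - H (min (f c) (f x)) = exp (h_top f) * (H x - H c)"
        using False c_bounds by (intro H(5)[where M = 3] height_image) auto
      then show ?thesis
        using H_mono[OF _ x(1), of c] False Q by (simp add: max.commute min.commute)
    qed
  qed
qed

text \<open>\<open>y j\<close> is the displacement of \<open>H\<close> at \<open>(f ^^ j) c\<close>
  from \<open>H c\<close>, with the sign chosen so that the turning point becomes a maximum.
  \<open>D\<close> is then the value at the turning point 0, and finiteness is inherited from the
  critical orbit.\<close>

lemma critical_orbit_tent:
  assumes s: "1 < exp (h_top f)" and fin: "finite (range (\<lambda>j. (f ^^ j) c))"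
  obtains y :: "nat \<Rightarrow> real" and D where "0 < D" "y 0 = 0"
    "\<And>j. y (Suc j) = D - exp (h_top f) * \<bar>y j\<bar>" "finite (range y)"
proof -
  \<comment> \<open>The endpoints and their images are included because the slope relation at 0 and
    1 gives \<open>0 < D\<close>.\<close>
  define Q where "Q = {0, 1, c, f 0, f 1} \<union> range (\<lambda>j. (f ^^ j) c)"
  define s where "s = exp (h_top f)"
  have s_gt_1: "1 < s"
    using s by (simp add: s_def)
  have orb: "(f ^^ j) c \<in> Q" for j
    by (auto simp: Q_def)
  have Q: "finite Q" "{0, 1, c} \<subseteq> Q" "Q \<subseteq> {0..1}" "f 0 \<in> Q" "f 1 \<in> Q"
    using fin c_bounds maps maps_funpow[of c] by (auto simp: Q_def)
  have fc: "f c \<in> Q"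
    using orb[of 1] by simp
  obtain H where H: "\<And>x. x \<in> Q \<Longrightarrow> 0 \<le> H x \<and> H x \<le> 1"
    "\<And>x y. x \<in> Q \<Longrightarrow> y \<in> Q \<Longrightarrow> x \<le> y \<Longrightarrow> H x \<le> H y"
    "H 0 = 0" "H 1 = 1"
    "\<And>x. x \<in> Q \<Longrightarrow> f x \<in> Q \<Longrightarrow> f c \<in> Q \<Longrightarrow>
       H (max (f x) (f c)) - H (min (f x) (f c)) = s * \<bar>H x - H c\<bar>"
    using semiconjugacy_weights[OF s Q(1-3)] unfolding s_def by blast
  have Hc: "0 \<le> H c" "H c \<le> 1" and Hf: "0 \<le> H (f 0)" "0 \<le> H (f 1)" "H (f 0) \<le> 1" "H (f 1) \<le> 1"
    and Hfc: "0 \<le> H (f c)" "H (f c) \<le> 1"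
    using H(1) Q fc by auto
  have fin_y: "finite (range (\<lambda>j. \<tau> * (H ((f ^^ j) c) - H c)))" for \<tau> :: real
    using finite_imageI[OF fin, of "\<lambda>x. \<tau> * (H x - H c)"] by (simp add: image_image)
  show thesis
  proof (cases rule: turning_point_extremum)
    case max
    have step: "H (f c) - H (f x) = s * \<bar>H x - H c\<bar>" if "x \<in> Q" "f x \<in> Q" for x
      using H(5)[OF that fc] max[of x] that Q(3) by (auto simp: max_absorb2 min_absorb1)
    \<comment> \<open>Otherwise the relation at 0 gives
      \<open>s * H c \<le> H (f c) \<le> H c\<close>, so \<open>H c\<close> and
      \<open>H (f c)\<close> are 0. The relation at 1 then reads \<open>- H (f 1) = s\<close>, which
      is impossible.\<close>
    have "0 < H (f c) - H c"
    proof (rule ccontr)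
      assume neg: "\<not> 0 < H (f c) - H c"
      have e0: "H (f c) - H (f 0) = s * H c" and e1: "H (f c) - H (f 1) = s * (1 - H c)"
        using step[of 0] step[of 1] Q Hc H(3,4) by auto
      have "(s - 1) * H c \<le> 0"
        using neg e0 Hf by (simp add: algebra_simps)
      then have "H c = 0"
        using s_gt_1 Hc by (simp add: mult_le_0_iff)
      then show False
        using neg e1 Hf s_gt_1 by simp
    qed
    moreover have "1 * (H ((f ^^ Suc j) c) - H c) = H (f c) - H c - s * \<bar>1 * (H ((f ^^ j) c) - H c)\<bar>" for j
      using step[OF orb[of j]] orb[of "Suc j"] by simp
    ultimately show thesis
      using that[of "H (f c) - H c" "\<lambda>j. 1 * (H ((f ^^ j) c) - H c)"] fin_y[of 1]
      by (simp add: s_def)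
  next
    case min
    have step: "H (f x) - H (f c) = s * \<bar>H x - H c\<bar>" if "x \<in> Q" "f x \<in> Q" for x
      using H(5)[OF that fc] min[of x] that Q(3) by (auto simp: max_absorb1 min_absorb2)
    \<comment> \<open>The mirror image: the relation at 1 forces \<open>H c = 1\<close>, and the
      relation at 0 then fails.\<close>
    have "0 < H c - H (f c)"
    proof (rule ccontr)
      assume neg: "\<not> 0 < H c - H (f c)"
      have e0: "H (f 0) - H (f c) = s * H c" and e1: "H (f 1) - H (f c) = s * (1 - H c)"
        using step[of 0] step[of 1] Q Hc H(3,4) by auto
      have "(s - 1) * (1 - H c) \<le> 0"
        using neg e1 Hf by (simp add: algebra_simps)
      then have "H c = 1"
        using s_gt_1 Hc by (simp add: mult_le_0_iff)
      then show False
        using neg e0 Hf s_gt_1 by simp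
    qed
    moreover have "-1 * (H ((f ^^ Suc j) c) - H c) = H c - H (f c) - s * \<bar>-1 * (H ((f ^^ j) c) - H c)\<bar>" for j
      using step[OF orb[of j]] orb[of "Suc j"] by (simp add: abs_minus_commute)
    ultimately show thesis
      using that[of "H c - H (f c)" "\<lambda>j. -1 * (H ((f ^^ j) c) - H c)"] fin_y[of "-1"]
      by (simp add: s_def)
  qed
qed

end

section \<open>Tent maps as generalized \<beta>-transformations\<close>

lemma beta_map_tent:
  assumes "1 < s" "x \<in> {0..1}"
  shows "beta_map 1 s (\<lambda>k. if k = 0 then 1 else -1) x = (if x \<le> 1 / s then s * x else 2 - s * x)"
proof -
  have "(THE k. k \<le> 1 \<and> x \<in> beta_interval 1 s k) = (if x \<le> 1 / s then 0 else 1)"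
  proof (rule the_equality)
    show "(if x \<le> 1 / s then 0 else 1) \<le> (1::nat) \<and>
        x \<in> beta_interval 1 s (if x \<le> 1 / s then 0 else 1)"
      using assms by (auto simp: beta_interval_def)
    show "k = (if x \<le> 1 / s then 0 else 1)" if "k \<le> 1 \<and> x \<in> beta_interval 1 s k" for k
      using that by (cases "k = 0") (auto simp: beta_interval_def)
  qed
  then show ?thesis
    by (simp add: beta_map_def)
qed

text \<open>The affine map \<open>X\<close> sends the turning point 0 to \<open>1 / s\<close> and
  its value \<open>D\<close> to 1, and it conjugates the recursion for \<open>y\<close> to the tent
  map. The orbit of 1 starts one step after the turning point, whence the index
  \<open>Suc j\<close>.\<close>

lemma generalized_parry_if_finite_tent_orbit:
  fixes s D :: real
  assumes s: "1 < s" "s \<le> 2" and D: "0 < D" and y: "y 0 = 0" "\<And>j. y (Suc j) = D - s * \<bar>y j\<bar>"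
    and fin: "finite (range y)"
  shows "generalized_parry s"
proof -
  let ?E = "\<lambda>k::nat. if k = 0 then 1 else -1 :: int"
  define X where "X u = u / D * (1 - 1 / s) + 1 / s" for u
  have q: "0 < 1 - 1 / s"
    using s by simp
  have "(beta_map 1 s ?E ^^ j) 1 = X (y (Suc j)) \<and> X (y (Suc j)) \<in> {0..1}" for j
  proof (induction j)
    case 0
    then show ?case
      using D y s by (simp add: X_def)
  next
    case (Suc j)
    define u where "u = y (Suc j)"
    have X01: "0 \<le> X u" "X u \<le> 1"
      using Suc by (auto simp: u_def)
    have le: "X u \<le> 1 / s \<longleftrightarrow> u \<le> 0"
      using q D by (simp add: X_def mult_le_0_iff divide_le_0_iff)
    have "(beta_map 1 s ?E ^^ Suc j) 1 = beta_map 1 s ?E (X u)"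
      using Suc by (simp add: u_def)
    also have "\<dots> = (if u \<le> 0 then s * X u else 2 - s * X u)"
      using beta_map_tent[OF s(1), of "X u"] X01 le by simp
    finally have eq1: "(beta_map 1 s ?E ^^ Suc j) 1 = (if u \<le> 0 then s * X u else 2 - s * X u)" .
    have eq2: "(if u \<le> 0 then s * X u else 2 - s * X u) = X (y (Suc (Suc j)))"
      unfolding y(2)[of "Suc j"] u_def[symmetric] using s D by (simp add: X_def field_simps)
    \<comment> \<open>Here \<open>s \<le> 2\<close> keeps the values of the decreasing branch
      nonnegative.\<close>
    have "s * X u \<le> 2" "0 \<le> s * X u"
      using mult_mono[of s 2 "X u" 1] s X01 by auto
    moreover have "s * X u \<le> 1" if "u \<le> 0"
      using le that s by (simp add: field_simps)
    moreover have "1 \<le> s * X u" if "\<not> u \<le> 0"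
      using le that s by (simp add: field_simps)
    ultimately show ?case
      unfolding eq1 eq2[symmetric] by auto
  qed
  then have "range (\<lambda>j. (beta_map 1 s ?E ^^ j) 1) \<subseteq> X ` range y"
    by auto
  then have "finite (range (\<lambda>j. (beta_map 1 s ?E ^^ j) 1))"
    using fin finite_subset by blast
  then show ?thesis
    unfolding generalized_parry_def using s by (intro exI[of _ 1] conjI exI[of _ ?E]) auto
qed

section \<open>Conjugates of 1 and the conclusion\<close>

lemma galois_conjugates_1: "galois_conjugates 1 = {}"
proof -
  have "z = 1" if p: "is_min_poly 1 p" and z: "poly (map_poly of_rat p) z = 0" for p and z :: complex
  proof -
    \<comment> \<open>Minimality is tested against the linear polynomial with root 1.\<close>
    have "degree p \<le> degree [:-1, 1:: rat:]"
      using p unfolding is_min_poly_def by (elim conjE allE[of _ "[:-1, 1:]"]) (auto simp: map_poly_pCons)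
    then have "p = [:coeff p 0, coeff p 1:]"
      by (intro poly_eqI) (auto simp: coeff_pCons coeff_eq_0 split: nat.split)
    then obtain d e where de: "p = [:d, e:]"
      by blast
    show ?thesis
    proof (cases "e = 0")
      case True
      then show ?thesis
        using p de by (auto simp: is_min_poly_def map_poly_pCons)
    next
      case False
      then have "e = 1"
        using p de by (simp add: is_min_poly_def)
      then show ?thesis
        using p z de by (auto simp: is_min_poly_def map_poly_pCons add_eq_0_iff)
    qed
  qed
  then show ?thesis
    by (auto simp: galois_conjugates_def)
qed

theorem mainTheorem6: "Omega_T \<subseteq> Omega"
proof
  fix z assume "z \<in> Omega_T"
  then obtain f where f: "pcf_unimodal f" and z: "z \<in> galois_conjugates (of_real (exp (h_top f)))"
    by (auto simp: Omega_T_def)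
  then obtain c where c: "turning_point f c" "finite (range (\<lambda>j. (f ^^ j) c))" and "unimodal f"
    by (auto simp: pcf_unimodal_def)
  then interpret unimodal_with_turning_point f c
    by unfold_locales (unfold unimodal_def, blast+)
  have "exp (h_top f) \<noteq> 1"
    using z galois_conjugates_1 by auto
  then have "1 < exp (h_top f)"
    using exp_h_top_bounds by simp
  then have "generalized_parry (exp (h_top f))"
    using critical_orbit_tent[OF _ c(2)] generalized_parry_if_finite_tent_orbit exp_h_top_bounds
    by metis
  then show "z \<in> Omega"
    using z by (auto simp: Omega_def)
qed

end
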